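(* Let $l\ge0$ be an integer. The dual space of $\mathcal S_l$ can be identified with $\mathcal S'/P_l$; that is, the restriction map $u\mapsto u|_{\mathcal S_l}$ from $\mathcal S'$ to $(\mathcal S_l)^*$ induces a linear isomorphism of $\mathcal S'/P_l$ onto $(\mathcal S_l)^*$.
   Context: $\mathcal S$ is the Schwartz space on $\mathbb R^d$ and $\mathcal S'$ the space of tempered distributions. $P_l$ is the space of polynomials on $\mathbb R^d$ of degree at most $l$, and $\mathcal S'/P_l$ is $\mathcal S'$ modulo the relation $u\sim v$ iff $u-v\in P_l$. $\mathcal S_l$ is the subspace of all $\varphi\in\mathcal S$ such that $\int x^\gamma\varphi(x)\,dx=0$ for every multi-index $\gamma$ with $|\gamma|\le l$, endowed with the topology inherited from $\mathcal S$; $(\mathcal S_l)^*$ is its space of continuous linear functionals. *)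

theory Defs
  imports "HOL-Analysis.Analysis"
begin

subsection \<open>Multi-indices and polynomials\<close>

text \<open>A multi-index on \<open>\<real>\<^sup>d\<close>, with \<open>d = CARD('n)\<close>, is a function \<open>'n \<Rightarrow> nat\<close>.\<close>

definition multi_deg :: "('n::finite \<Rightarrow> nat) \<Rightarrow> nat" where
  "multi_deg \<gamma> = (\<Sum>i\<in>UNIV. \<gamma> i)"

definition mono_fun :: "('n::finite \<Rightarrow> nat) \<Rightarrow> real ^ 'n \<Rightarrow> complex" where
  "mono_fun \<gamma> x = (\<Prod>i\<in>UNIV. complex_of_real (x $ i) ^ \<gamma> i)"

lemma finite_multi_deg_le: "finite {\<gamma> :: 'n::finite \<Rightarrow> nat. multi_deg \<gamma> \<le> l}"
proof (rule finite_subset)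
  show "{\<gamma> :: 'n \<Rightarrow> nat. multi_deg \<gamma> \<le> l} \<subseteq> (UNIV :: 'n set) \<rightarrow>\<^sub>E {..l}"
  proof
    fix \<gamma> :: "'n \<Rightarrow> nat"
    assume "\<gamma> \<in> {\<gamma>. multi_deg \<gamma> \<le> l}"
    moreover have "\<gamma> i \<le> multi_deg \<gamma>" for i
      unfolding multi_deg_def by (rule member_le_sum) auto
    ultimately show "\<gamma> \<in> (UNIV :: 'n set) \<rightarrow>\<^sub>E {..l}"
      by (auto intro: order_trans)
  qed
  show "finite ((UNIV :: 'n set) \<rightarrow>\<^sub>E {..l})"
    by (rule finite_PiE) auto
qed

definition polys_le :: "nat \<Rightarrow> (real ^ 'n::finite \<Rightarrow> complex) set" where
  "polys_le l = {p. \<exists>a. p = (\<lambda>x. \<Sum>\<gamma> | multi_deg \<gamma> \<le> l. a \<gamma> * mono_fun \<gamma> x)}"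


subsection \<open>The Schwartz space\<close>

text \<open>Iterated partial derivatives are indexed by lists of coordinate directions. On smooth
  functions the order of the directions is irrelevant, so these are the derivatives
  \<open>\<partial>\<^sup>\<beta>\<close> for multi-indices \<open>\<beta>\<close>, each occurring once for every ordering.\<close>

primrec partials :: "'n::finite list \<Rightarrow> (real ^ 'n \<Rightarrow> complex) \<Rightarrow> real ^ 'n \<Rightarrow> complex" where
  "partials [] f = f"
| "partials (i # is) f = (\<lambda>x. frechet_derivative (partials is f) (at x) (axis i 1))"

definition smooth :: "(real ^ 'n::finite \<Rightarrow> complex) \<Rightarrow> bool" where
  "smooth f \<longleftrightarrow> (\<forall>is x. partials is f differentiable (at x))"

definition schwartz :: "(real ^ 'n::finite \<Rightarrow> complex) set" where
  "schwartz = {f. smooth f \<and>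
     (\<forall>\<alpha> is. bounded (range (\<lambda>x. mono_fun \<alpha> x * partials is f x)))}"

definition schwartz_seminorm ::
    "('n::finite \<Rightarrow> nat) \<Rightarrow> 'n list \<Rightarrow> (real ^ 'n \<Rightarrow> complex) \<Rightarrow> real" where
  "schwartz_seminorm \<alpha> is f = (SUP x. norm (mono_fun \<alpha> x * partials is f x))"

text \<open>The seminorm balls around all points form a subbase of the locally convex topology.\<close>

definition schwartz_topology :: "(real ^ 'n::finite \<Rightarrow> complex) topology" where
  "schwartz_topology = topology_generated_by
     {{g \<in> schwartz. schwartz_seminorm \<alpha> is (\<lambda>x. g x - f x) < e} | \<alpha> is f e.
        f \<in> schwartz \<and> 0 < e}"

definition schwartz_moment :: "nat \<Rightarrow> (real ^ 'n::finite \<Rightarrow> complex) set" where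
  "schwartz_moment l = {\<phi> \<in> schwartz.
     \<forall>\<gamma>. multi_deg \<gamma> \<le> l \<longrightarrow> (LINT x|lborel. mono_fun \<gamma> x * \<phi> x) = 0}"

definition schwartz_moment_topology :: "nat \<Rightarrow> (real ^ 'n::finite \<Rightarrow> complex) topology" where
  "schwartz_moment_topology l = subtopology schwartz_topology (schwartz_moment l)"


subsection \<open>Dual spaces\<close>

text \<open>Functionals on a space of functions are represented by total functions that vanish outside
  that space, so that equality of functionals is equality of functions and the vector space
  operations on a dual space are pointwise.\<close>

definition continuous_dual :: "('a \<Rightarrow> complex) topology \<Rightarrow> (('a \<Rightarrow> complex) \<Rightarrow> complex) set" where
  "continuous_dual T = {u.
     (\<forall>\<phi>\<in>topspace T. \<forall>\<psi>\<in>topspace T. u (\<lambda>x. \<phi> x + \<psi> x) = u \<phi> + u \<psi>) \<and>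
     (\<forall>c. \<forall>\<phi>\<in>topspace T. u (\<lambda>x. c * \<phi> x) = c * u \<phi>) \<and>
     continuous_map T euclidean u \<and>
     (\<forall>\<phi>. \<phi> \<notin> topspace T \<longrightarrow> u \<phi> = 0)}"

definition restrict_functional ::
    "('a \<Rightarrow> complex) set \<Rightarrow> (('a \<Rightarrow> complex) \<Rightarrow> complex) \<Rightarrow> ('a \<Rightarrow> complex) \<Rightarrow> complex" where
  "restrict_functional X u = (\<lambda>\<phi>. if \<phi> \<in> X then u \<phi> else 0)"

definition tempered :: "((real ^ 'n::finite \<Rightarrow> complex) \<Rightarrow> complex) set" where
  "tempered = continuous_dual schwartz_topology"

text \<open>The distribution \<open>\<phi> \<mapsto> \<integral> p(x) \<phi>(x) dx\<close> with which a polynomial \<open>p\<close> is identified.\<close>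

definition distr_of_fun ::
    "(real ^ 'n::finite \<Rightarrow> complex) \<Rightarrow> (real ^ 'n \<Rightarrow> complex) \<Rightarrow> complex" where
  "distr_of_fun p = restrict_functional schwartz (\<lambda>\<phi>. LINT x|lborel. p x * \<phi> x)"


subsection \<open>The quotient of the tempered distributions by the polynomials\<close>

definition poly_rel :: "nat \<Rightarrow> ((real ^ 'n::finite \<Rightarrow> complex) \<Rightarrow> complex) rel" where
  "poly_rel l = {(u, v). u \<in> tempered \<and> v \<in> tempered \<and>
     (\<lambda>\<phi>. u \<phi> - v \<phi>) \<in> distr_of_fun ` polys_le l}"

definition tempered_mod :: "nat \<Rightarrow> ((real ^ 'n::finite \<Rightarrow> complex) \<Rightarrow> complex) set set" where
  "tempered_mod l = tempered // poly_rel l"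

definition quot_add :: "nat \<Rightarrow> ((real ^ 'n::finite \<Rightarrow> complex) \<Rightarrow> complex) set \<Rightarrow>
    ((real ^ 'n \<Rightarrow> complex) \<Rightarrow> complex) set \<Rightarrow> ((real ^ 'n \<Rightarrow> complex) \<Rightarrow> complex) set" where
  "quot_add l C D = (\<Union>u\<in>C. \<Union>v\<in>D. poly_rel l `` {\<lambda>\<phi>. u \<phi> + v \<phi>})"

definition quot_scale :: "nat \<Rightarrow> complex \<Rightarrow> ((real ^ 'n::finite \<Rightarrow> complex) \<Rightarrow> complex) set \<Rightarrow>
    ((real ^ 'n \<Rightarrow> complex) \<Rightarrow> complex) set" where
  "quot_scale l c C = (\<Union>u\<in>C. poly_rel l `` {\<lambda>\<phi>. c * u \<phi>})"

end

theory Submission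
  imports Defs "HOL-Probability.Sinc_Integral"
begin

text \<open>
  The space of Schwartz functions with vanishing moments up to order \<open>l\<close> has finite codimension: it
  is the joint kernel of the finitely many moments \<open>m\<^sub>\<gamma> \<phi> = \<integral> x\<^sup>\<gamma> \<phi>(x) dx\<close> with \<open>\<bar>\<gamma>\<bar> \<le> l\<close>. Linear algebra
  alone (\<open>joint_kernel_complement\<close>) gives Schwartz functions \<open>e\<^sub>\<gamma>\<close> for which
  \<open>P \<phi> = \<phi> - \<Sum>\<^sub>\<gamma> m\<^sub>\<gamma>(\<phi>) e\<^sub>\<gamma>\<close> has vanishing moments for every Schwartz function \<open>\<phi>\<close>. Thus \<open>P\<close> is a
  projection onto the joint kernel, and it is continuous because each moment is bounded by finitely
  many Schwartz seminorms (\<open>moment_projection\<close>).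

  Both halves of the theorem are read off from \<open>P\<close>. A continuous functional \<open>v\<close> on the joint kernel
  extends to the tempered distribution \<open>v \<circ> P\<close>, so restriction is onto and the Hahn-Banach theorem
  is avoided (\<open>extend_to_tempered\<close>). A tempered distribution \<open>w\<close> that vanishes on the joint kernel
  satisfies \<open>w(P \<phi>) = 0\<close>, that is, \<open>w(\<phi>) = \<Sum>\<^sub>\<gamma> w(e\<^sub>\<gamma>) m\<^sub>\<gamma>(\<phi>)\<close>, which is integration against the polynomial
  \<open>\<Sum>\<^sub>\<gamma> w(e\<^sub>\<gamma>) x\<^sup>\<gamma>\<close> (\<open>annihilator_schwartz_moment\<close>). Hence two tempered distributions are equivalent
  modulo polynomials exactly when their restrictions agree (\<open>poly_rel_iff_restrict_eq\<close>), and
  restriction descends to an injective linear map on the quotient.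
\<close>

section \<open>Joint kernels of finitely many linear forms\<close>

definition function_subspace :: "('a \<Rightarrow> complex) set \<Rightarrow> bool" where
  "function_subspace X \<longleftrightarrow> (\<lambda>x. 0) \<in> X \<and>
     (\<forall>f\<in>X. \<forall>g\<in>X. (\<lambda>x. f x + g x) \<in> X) \<and> (\<forall>c. \<forall>f\<in>X. (\<lambda>x. c * f x) \<in> X)"

definition linear_form_on :: "('a \<Rightarrow> complex) set \<Rightarrow> (('a \<Rightarrow> complex) \<Rightarrow> complex) \<Rightarrow> bool" where
  "linear_form_on X u \<longleftrightarrow>
     (\<forall>f\<in>X. \<forall>g\<in>X. u (\<lambda>x. f x + g x) = u f + u g) \<and> (\<forall>c. \<forall>f\<in>X. u (\<lambda>x. c * f x) = c * u f)"

definition joint_kernel ::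
    "('a \<Rightarrow> complex) set \<Rightarrow> 'i set \<Rightarrow> ('i \<Rightarrow> ('a \<Rightarrow> complex) \<Rightarrow> complex) \<Rightarrow> ('a \<Rightarrow> complex) set" where
  "joint_kernel X I m = {f \<in> X. \<forall>i\<in>I. m i f = 0}"

lemma function_subspace_zero: "function_subspace X \<Longrightarrow> (\<lambda>x. 0) \<in> X"
  by (simp add: function_subspace_def)

lemma function_subspace_add:
  "function_subspace X \<Longrightarrow> f \<in> X \<Longrightarrow> g \<in> X \<Longrightarrow> (\<lambda>x. f x + g x) \<in> X"
  by (simp add: function_subspace_def)

lemma function_subspace_scale: "function_subspace X \<Longrightarrow> f \<in> X \<Longrightarrow> (\<lambda>x. c * f x) \<in> X"
  by (simp add: function_subspace_def)

lemma function_subspace_diff: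
  assumes "function_subspace X" "f \<in> X" "g \<in> X"
  shows "(\<lambda>x. f x - g x) \<in> X"
  using function_subspace_add[OF assms(1,2) function_subspace_scale[OF assms(1,3), of "-1"]] by simp

lemma function_subspace_lincomb:
  assumes "function_subspace X" "finite I" "\<And>i. i \<in> I \<Longrightarrow> e i \<in> X"
  shows "(\<lambda>x. \<Sum>i\<in>I. c i * e i x) \<in> X"
  using assms(2,3)
  by (induction I)
    (auto simp: function_subspace_zero[OF assms(1)]
      intro!: function_subspace_add[OF assms(1)] function_subspace_scale[OF assms(1)])

lemma linear_form_on_add:
  "linear_form_on X u \<Longrightarrow> f \<in> X \<Longrightarrow> g \<in> X \<Longrightarrow> u (\<lambda>x. f x + g x) = u f + u g"
  by (simp add: linear_form_on_def)

lemma linear_form_on_scale: "linear_form_on X u \<Longrightarrow> f \<in> X \<Longrightarrow> u (\<lambda>x. c * f x) = c * u f"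
  by (simp add: linear_form_on_def)

lemma linear_form_on_diff:
  assumes "function_subspace X" "linear_form_on X u" "f \<in> X" "g \<in> X"
  shows "u (\<lambda>x. f x - g x) = u f - u g"
  using linear_form_on_add[OF assms(2,3) function_subspace_scale[OF assms(1,4), of "-1"]]
    linear_form_on_scale[OF assms(2,4), of "-1"] by simp

lemma linear_form_on_lincomb:
  assumes X: "function_subspace X" and u: "linear_form_on X u"
    and "finite I" "\<And>i. i \<in> I \<Longrightarrow> e i \<in> X"
  shows "u (\<lambda>x. \<Sum>i\<in>I. c i * e i x) = (\<Sum>i\<in>I. c i * u (e i))"
  using assms(3,4)
proof (induction I)
  case empty
  show ?case
    using linear_form_on_scale[OF u function_subspace_zero[OF X], of 0] by simp
next
  case (insert i I)
  have "u (\<lambda>x. c i * e i x + (\<Sum>i\<in>I. c i * e i x)) = u (\<lambda>x. c i * e i x) + u (\<lambda>x. \<Sum>i\<in>I. c i * e i x)"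
    using insert X by (intro linear_form_on_add[OF u] function_subspace_scale function_subspace_lincomb) auto
  then show ?case
    using insert linear_form_on_scale[OF u] by simp
qed

text \<open>
  The forms are taken in one at a time. If the next form \<open>m j\<close> vanishes on the kernel \<open>N\<close> of the
  earlier ones, it is redundant and receives the correction \<open>0\<close>. Otherwise some \<open>g \<in> N\<close> has
  \<open>m j g = 1\<close>; subtracting \<open>m j h \<cdot> g\<close> from the earlier projection \<open>h\<close> of \<open>f\<close> also annihilates
  \<open>m j\<close> and does not disturb the other forms. Admitting redundant forms
  makes the lemma applicable to any finite family.
\<close>
lemma joint_kernel_complement:
  assumes X: "function_subspace X" and "finite I"
    and "\<And>i. i \<in> I \<Longrightarrow> linear_form_on X (m i)"
  shows "\<exists>e. (\<forall>i\<in>I. e i \<in> X) \<and> (\<forall>f\<in>X. (\<lambda>x. f x - (\<Sum>i\<in>I. m i f * e i x)) \<in> joint_kernel X I m)"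
  using assms(2,3)
proof (induction I)
  case empty
  show ?case by (auto simp: joint_kernel_def)
next
  case (insert j I)
  have mj: "linear_form_on X (m j)"
    using insert.prems by simp
  obtain e where eX: "\<And>i. i \<in> I \<Longrightarrow> e i \<in> X"
    and e: "\<And>f. f \<in> X \<Longrightarrow> (\<lambda>x. f x - (\<Sum>i\<in>I. m i f * e i x)) \<in> joint_kernel X I m"
    using insert by fastforce
  show ?case
  proof (cases "\<forall>g\<in>joint_kernel X I m. m j g = 0")
    case True
    then have K: "joint_kernel X (insert j I) m = joint_kernel X I m"
      by (auto simp: joint_kernel_def)
    have sums: "(\<Sum>i\<in>insert j I. m i f * (e(j := \<lambda>x. 0)) i x) = (\<Sum>i\<in>I. m i f * e i x)" for f x
      using insert.hyps by (auto intro!: sum.cong)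
    show ?thesis
      using eX e function_subspace_zero[OF X]
      by (intro exI[of _ "e(j := \<lambda>x. 0)"]) (auto simp only: K sums, auto)
  next
    case False
    then obtain g0 where g0: "g0 \<in> joint_kernel X I m" "m j g0 \<noteq> 0"
      by blast
    define g where "g = (\<lambda>x. (1 / m j g0) * g0 x)"
    have g0X: "g0 \<in> X" and g0I: "\<And>i. i \<in> I \<Longrightarrow> m i g0 = 0"
      using g0(1) by (auto simp: joint_kernel_def)
    have gX: "g \<in> X"
      unfolding g_def by (rule function_subspace_scale[OF X g0X])
    have mg: "m i g = (1 / m j g0) * m i g0" if "i \<in> insert j I" for i
      unfolding g_def by (rule linear_form_on_scale[OF insert.prems[OF that] g0X])
    have gI: "\<And>i. i \<in> I \<Longrightarrow> m i g = 0" and gj: "m j g = 1"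
      using mg g0I g0(2) by auto
    \<comment> \<open>\<open>m j h\<close> itself depends on \<open>f\<close> through all the forms, so that expanding it changes the
      coefficient of every earlier \<open>m i f\<close> by a multiple of \<open>g\<close>.\<close>
    define e' where "e' = (\<lambda>i. if i = j then g else (\<lambda>x. e i x - m j (e i) * g x))"
    have "(\<lambda>x. f x - (\<Sum>i\<in>insert j I. m i f * e' i x)) \<in> joint_kernel X (insert j I) m" if f: "f \<in> X" for f
    proof -
      define h where "h = (\<lambda>x. f x - (\<Sum>i\<in>I. m i f * e i x))"
      have h: "h \<in> joint_kernel X I m"
        using e[OF f] by (simp add: h_def)
      then have hX: "h \<in> X"
        by (simp add: joint_kernel_def)
      have mh: "m j h = m j f - (\<Sum>i\<in>I. m i f * m j (e i))"
        unfolding h_def using insert.hyps(1) eX f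
        by (subst linear_form_on_diff[OF X mj f])
          (auto intro!: function_subspace_lincomb[OF X] simp: linear_form_on_lincomb[OF X mj])
      have "(\<lambda>x. f x - (\<Sum>i\<in>insert j I. m i f * e' i x)) = (\<lambda>x. h x - m j h * g x)"
      proof
        fix x
        have "(\<Sum>i\<in>I. m i f * e' i x) = (\<Sum>i\<in>I. m i f * (e i x - m j (e i) * g x))"
          using insert.hyps(2) by (intro sum.cong) (auto simp: e'_def)
        also have "\<dots> = (\<Sum>i\<in>I. m i f * e i x) - (\<Sum>i\<in>I. m i f * m j (e i)) * g x"
          by (simp add: algebra_simps sum_subtractf sum_distrib_left sum_distrib_right)
        finally have sum_I: "(\<Sum>i\<in>I. m i f * e' i x) =
            (\<Sum>i\<in>I. m i f * e i x) - (\<Sum>i\<in>I. m i f * m j (e i)) * g x" .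
        have "(\<Sum>i\<in>insert j I. m i f * e' i x) = m j f * g x + (\<Sum>i\<in>I. m i f * e' i x)"
          using insert.hyps by (simp add: e'_def)
        then show "f x - (\<Sum>i\<in>insert j I. m i f * e' i x) = h x - m j h * g x"
          unfolding mh sum_I by (simp add: h_def left_diff_distrib)
      qed
      moreover have "(\<lambda>x. h x - m j h * g x) \<in> X"
        by (intro function_subspace_diff[OF X] function_subspace_scale[OF X] hX gX)
      moreover have "m i (\<lambda>x. h x - m j h * g x) = m i h - m j h * m i g" if "i \<in> insert j I" for i
        using linear_form_on_diff[OF X insert.prems[OF that] hX function_subspace_scale[OF X gX]]
          linear_form_on_scale[OF insert.prems[OF that] gX] by simp
      ultimately show ?thesis
        using h gI gj by (auto simp: joint_kernel_def)
    qed
    moreover have "\<forall>i\<in>insert j I. e' i \<in> X"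
      using eX gX by (auto simp: e'_def intro!: function_subspace_diff[OF X] function_subspace_scale[OF X])
    ultimately show ?thesis by blast
  qed
qed


section \<open>The Schwartz space and its seminorms\<close>

lemma partials_add:
  assumes "smooth f" "smooth g"
  shows "partials is (\<lambda>x. f x + g x) = (\<lambda>x. partials is f x + partials is g x)"
proof (induction "is")
  case (Cons i "is")
  have "partials (i # is) (\<lambda>x. f x + g x) x = partials (i # is) f x + partials (i # is) g x" for x
  proof -
    have "((\<lambda>x. partials is f x + partials is g x) has_derivative
        (\<lambda>h. frechet_derivative (partials is f) (at x) h + frechet_derivative (partials is g) (at x) h)) (at x)"
      using assms by (intro has_derivative_add) (auto simp: smooth_def frechet_derivative_works[symmetric])
    then show ?thesis
      unfolding partials.simps Cons.IH by (subst frechet_derivative_at[symmetric]) auto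
  qed
  then show ?case by blast
qed simp

lemma partials_scale:
  assumes "smooth f"
  shows "partials is (\<lambda>x. c * f x) = (\<lambda>x. c * partials is f x)"
proof (induction "is")
  case (Cons i "is")
  have "partials (i # is) (\<lambda>x. c * f x) x = c * partials (i # is) f x" for x
  proof -
    have "((\<lambda>x. c * partials is f x) has_derivative
        (\<lambda>h. c * frechet_derivative (partials is f) (at x) h)) (at x)"
      using assms by (intro has_derivative_mult_right) (auto simp: smooth_def frechet_derivative_works[symmetric])
    then show ?thesis
      unfolding partials.simps Cons.IH by (subst frechet_derivative_at[symmetric]) auto
  qed
  then show ?case by blast
qed simp

lemma partials_zero: "partials is (\<lambda>x. 0) = (\<lambda>x. 0)"
  by (induction "is") auto

lemma smooth_add: "smooth f \<Longrightarrow> smooth g \<Longrightarrow> smooth (\<lambda>x. f x + g x)"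
  by (subst smooth_def) (auto simp: partials_add, auto simp: smooth_def)

lemma smooth_scale: "smooth f \<Longrightarrow> smooth (\<lambda>x. c * f x)"
  by (subst smooth_def) (auto simp: partials_scale, auto simp: smooth_def intro!: differentiable_mult)

lemma function_subspace_schwartz: "function_subspace (schwartz :: (real ^ 'n::finite \<Rightarrow> complex) set)"
  unfolding function_subspace_def
proof (intro conjI ballI allI)
  show "(\<lambda>x. 0) \<in> (schwartz :: (real ^ 'n \<Rightarrow> complex) set)"
    by (simp add: schwartz_def smooth_def partials_zero image_constant_conv)
next
  fix f g :: "real ^ 'n \<Rightarrow> complex"
  assume f: "f \<in> schwartz" and g: "g \<in> schwartz"
  then have s: "smooth f" "smooth g" by (auto simp: schwartz_def)
  have "bounded (range (\<lambda>x. mono_fun \<alpha> x * partials is (\<lambda>x. f x + g x) x))" for \<alpha> "is"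
  proof -
    have "bounded (range (\<lambda>x. mono_fun \<alpha> x * partials is f x + mono_fun \<alpha> x * partials is g x))"
      using f g by (intro bounded_plus_comp) (auto simp: schwartz_def)
    then show ?thesis by (simp add: partials_add[OF s] distrib_left)
  qed
  then show "(\<lambda>x. f x + g x) \<in> schwartz"
    by (simp add: schwartz_def smooth_add[OF s])
next
  fix f :: "real ^ 'n \<Rightarrow> complex" and c
  assume f: "f \<in> schwartz"
  then have s: "smooth f" by (auto simp: schwartz_def)
  have "bounded (range (\<lambda>x. mono_fun \<alpha> x * partials is (\<lambda>x. c * f x) x))" for \<alpha> "is"
  proof -
    have "bounded ((\<lambda>z. c * z) ` range (\<lambda>x. mono_fun \<alpha> x * partials is f x))"
      using f by (intro bounded_linear_image[OF _ bounded_linear_mult_right]) (auto simp: schwartz_def)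
    then show ?thesis by (simp add: partials_scale[OF s] image_image algebra_simps)
  qed
  then show "(\<lambda>x. c * f x) \<in> schwartz"
    by (simp add: schwartz_def smooth_scale[OF s])
qed

lemmas schwartz_zero = function_subspace_zero[OF function_subspace_schwartz]
lemmas schwartz_add = function_subspace_add[OF function_subspace_schwartz]
lemmas schwartz_scale = function_subspace_scale[OF function_subspace_schwartz]
lemmas schwartz_diff = function_subspace_diff[OF function_subspace_schwartz]
lemmas schwartz_lincomb = function_subspace_lincomb[OF function_subspace_schwartz]

lemma schwartz_seminorm_upper:
  assumes "f \<in> schwartz"
  shows "norm (mono_fun \<alpha> x * partials is f x) \<le> schwartz_seminorm \<alpha> is f"
  unfolding schwartz_seminorm_def
proof (rule cSUP_upper)
  have "bounded (range (\<lambda>x. mono_fun \<alpha> x * partials is f x))"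
    using assms by (simp add: schwartz_def)
  then obtain b where "\<And>x. norm (mono_fun \<alpha> x * partials is f x) \<le> b"
    unfolding bounded_iff by blast
  then show "bdd_above (range (\<lambda>x. norm (mono_fun \<alpha> x * partials is f x)))"
    by (intro bdd_aboveI[of _ b]) auto
qed simp

lemma schwartz_seminorm_least:
  assumes "\<And>x. norm (mono_fun \<alpha> x * partials is f x) \<le> c"
  shows "schwartz_seminorm \<alpha> is f \<le> c"
  unfolding schwartz_seminorm_def by (rule cSUP_least) (use assms in auto)

lemma schwartz_seminorm_nonneg:
  assumes "f \<in> schwartz" shows "0 \<le> schwartz_seminorm \<alpha> is f"
  using schwartz_seminorm_upper[OF assms, of \<alpha> 0 "is"] norm_ge_zero order_trans by blast

lemma schwartz_seminorm_zero: "schwartz_seminorm \<alpha> is (\<lambda>x. 0) = 0"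
  by (simp add: schwartz_seminorm_def partials_zero)

lemma schwartz_seminorm_add:
  assumes f: "f \<in> schwartz" and g: "g \<in> schwartz"
  shows "schwartz_seminorm \<alpha> is (\<lambda>x. f x + g x) \<le> schwartz_seminorm \<alpha> is f + schwartz_seminorm \<alpha> is g"
proof (rule schwartz_seminorm_least)
  fix x
  have s: "smooth f" "smooth g" using f g by (auto simp: schwartz_def)
  have "norm (mono_fun \<alpha> x * partials is f x + mono_fun \<alpha> x * partials is g x)
      \<le> schwartz_seminorm \<alpha> is f + schwartz_seminorm \<alpha> is g"
    by (intro norm_triangle_mono schwartz_seminorm_upper f g)
  then show "norm (mono_fun \<alpha> x * partials is (\<lambda>x. f x + g x) x)
      \<le> schwartz_seminorm \<alpha> is f + schwartz_seminorm \<alpha> is g"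
    by (simp add: partials_add[OF s] distrib_left)
qed

lemma schwartz_seminorm_scale:
  assumes f: "f \<in> schwartz"
  shows "schwartz_seminorm \<alpha> is (\<lambda>x. c * f x) \<le> norm c * schwartz_seminorm \<alpha> is f"
proof (rule schwartz_seminorm_least)
  fix x
  have s: "smooth f" using f by (auto simp: schwartz_def)
  have "norm c * norm (mono_fun \<alpha> x * partials is f x) \<le> norm c * schwartz_seminorm \<alpha> is f"
    by (intro mult_left_mono schwartz_seminorm_upper f) auto
  then show "norm (mono_fun \<alpha> x * partials is (\<lambda>x. c * f x) x) \<le> norm c * schwartz_seminorm \<alpha> is f"
    by (simp add: partials_scale[OF s] norm_mult algebra_simps)
qed

lemma schwartz_seminorm_lincomb:
  assumes "finite I" "\<And>i. i \<in> I \<Longrightarrow> e i \<in> schwartz"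
  shows "schwartz_seminorm \<alpha> is (\<lambda>x. \<Sum>i\<in>I. c i * e i x)
    \<le> (\<Sum>i\<in>I. norm (c i) * schwartz_seminorm \<alpha> is (e i))"
  using assms
proof (induction I)
  case empty
  show ?case by (simp add: schwartz_seminorm_zero)
next
  case (insert i I)
  have "schwartz_seminorm \<alpha> is (\<lambda>x. c i * e i x + (\<Sum>i\<in>I. c i * e i x))
      \<le> schwartz_seminorm \<alpha> is (\<lambda>x. c i * e i x) + schwartz_seminorm \<alpha> is (\<lambda>x. \<Sum>i\<in>I. c i * e i x)"
    using insert by (intro schwartz_seminorm_add schwartz_scale schwartz_lincomb) auto
  also have "\<dots> \<le> norm (c i) * schwartz_seminorm \<alpha> is (e i) + (\<Sum>i\<in>I. norm (c i) * schwartz_seminorm \<alpha> is (e i))"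
    using insert by (intro add_mono schwartz_seminorm_scale) auto
  finally show ?case using insert by simp
qed


section \<open>Continuity on the Schwartz space\<close>

text \<open>
  For a seminorm \<open>p\<close> this is continuity on the Schwartz space. Bounding by a sum over a finite set of
  Schwartz seminorms makes the property closed under sums and nonnegative multiples.
\<close>
definition seminorm_dominated :: "((real ^ 'n::finite \<Rightarrow> complex) \<Rightarrow> real) \<Rightarrow> bool" where
  "seminorm_dominated p \<longleftrightarrow> (\<exists>B K. finite B \<and> 0 \<le> K \<and>
     (\<forall>f\<in>schwartz. p f \<le> K * (\<Sum>(\<alpha>, is)\<in>B. schwartz_seminorm \<alpha> is f)))"

lemma seminorm_dominated_seminorm: "seminorm_dominated (schwartz_seminorm \<alpha> is)"
  unfolding seminorm_dominated_def by (intro exI[of _ "{(\<alpha>, is)}"] exI[of _ 1]) auto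

lemma seminorm_dominated_mono:
  "seminorm_dominated p \<Longrightarrow> (\<And>f. f \<in> schwartz \<Longrightarrow> q f \<le> p f) \<Longrightarrow> seminorm_dominated q"
  unfolding seminorm_dominated_def by (meson order_trans)

lemma seminorm_dominated_add:
  fixes p q :: "(real ^ 'n::finite \<Rightarrow> complex) \<Rightarrow> real"
  assumes "seminorm_dominated p" "seminorm_dominated q"
  shows "seminorm_dominated (\<lambda>f. p f + q f)"
proof -
  let ?s = "\<lambda>B f. \<Sum>(\<alpha>, is)\<in>B. schwartz_seminorm \<alpha> is (f :: real ^ 'n \<Rightarrow> complex)"
  obtain B K where B: "finite B" "0 \<le> K" "\<And>f. f \<in> schwartz \<Longrightarrow> p f \<le> K * ?s B f"
    using assms(1) unfolding seminorm_dominated_def by blast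
  obtain C L where C: "finite C" "0 \<le> L" "\<And>f. f \<in> schwartz \<Longrightarrow> q f \<le> L * ?s C f"
    using assms(2) unfolding seminorm_dominated_def by blast
  have "p f + q f \<le> (K + L) * ?s (B \<union> C) f" if f: "f \<in> schwartz" for f
  proof -
    have "?s B f \<le> ?s (B \<union> C) f" "?s C f \<le> ?s (B \<union> C) f"
      using B(1) C(1) schwartz_seminorm_nonneg[OF f] by (auto intro!: sum_mono2)
    then have "K * ?s B f + L * ?s C f \<le> K * ?s (B \<union> C) f + L * ?s (B \<union> C) f"
      using B(2) C(2) by (intro add_mono mult_left_mono)
    then show ?thesis
      using B(3)[OF f] C(3)[OF f] by (simp add: distrib_right)
  qed
  then show ?thesis
    unfolding seminorm_dominated_def using B C by (intro exI[of _ "B \<union> C"] exI[of _ "K + L"]) auto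
qed

lemma seminorm_dominated_scale:
  assumes "seminorm_dominated p" "0 \<le> c"
  shows "seminorm_dominated (\<lambda>f. p f * c)"
proof -
  obtain B K where B: "finite B" "0 \<le> K"
    "\<And>f. f \<in> schwartz \<Longrightarrow> p f \<le> K * (\<Sum>(\<alpha>, is)\<in>B. schwartz_seminorm \<alpha> is f)"
    using assms(1) unfolding seminorm_dominated_def by blast
  have "p f * c \<le> (K * c) * (\<Sum>(\<alpha>, is)\<in>B. schwartz_seminorm \<alpha> is f)" if "f \<in> schwartz" for f
    using mult_right_mono[OF B(3)[OF that] assms(2)] by (simp add: algebra_simps)
  then show ?thesis
    unfolding seminorm_dominated_def using B assms(2) by (intro exI[of _ B] exI[of _ "K * c"]) auto
qed

lemma seminorm_dominated_sum:
  assumes "finite I" "\<And>i. i \<in> I \<Longrightarrow> seminorm_dominated (p i)"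
  shows "seminorm_dominated (\<lambda>f. \<Sum>i\<in>I. p i f)"
  using assms
proof (induction I)
  case empty
  show ?case unfolding seminorm_dominated_def by (intro exI[of _ "{}"] exI[of _ 0]) auto
next
  case (insert i I)
  then show ?case using seminorm_dominated_add[of "p i" "\<lambda>f. \<Sum>i\<in>I. p i f"] by simp
qed

lemma topspace_schwartz [simp]: "topspace schwartz_topology = schwartz"
proof
  show "topspace schwartz_topology \<subseteq> schwartz"
    unfolding schwartz_topology_def topology_generated_by_topspace by blast
  show "schwartz \<subseteq> topspace schwartz_topology"
  proof
    fix f :: "real ^ 'n \<Rightarrow> complex"
    assume f: "f \<in> schwartz"
    then have "f \<in> {g \<in> schwartz. schwartz_seminorm (\<lambda>_. 0) [] (\<lambda>x. g x - f x) < 1}"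
      by (simp add: schwartz_seminorm_zero)
    then show "f \<in> topspace schwartz_topology"
      unfolding schwartz_topology_def topology_generated_by_topspace
      using f zero_less_one by blast
  qed
qed

lemma topspace_schwartz_moment [simp]:
  "topspace (schwartz_moment_topology l) = schwartz_moment l"
  by (auto simp: schwartz_moment_topology_def schwartz_moment_def)

lemma openin_schwartz_seminorm_ball:
  "f \<in> schwartz \<Longrightarrow> 0 < e \<Longrightarrow>
    openin schwartz_topology {g \<in> schwartz. schwartz_seminorm \<alpha> is (\<lambda>x. g x - f x) < e}"
  unfolding schwartz_topology_def by (rule topology_generated_by_Basis) blast

text \<open>
  Each of the finitely many dominating seminorms can be kept below \<open>\<delta>\<close> on a subbasic ball around
  \<open>f\<close>, and the intersection of these balls is the neighbourhood.
\<close>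
lemma seminorm_dominated_nbhd:
  fixes f :: "real ^ 'n::finite \<Rightarrow> complex"
  assumes p: "seminorm_dominated p" and f: "f \<in> schwartz" and r: "0 < r"
  shows "\<exists>N. openin schwartz_topology N \<and> f \<in> N \<and> (\<forall>g\<in>N. p (\<lambda>x. g x - f x) < r)"
proof -
  obtain B K where B: "finite B" and K: "0 \<le> K"
    and le: "\<And>h. h \<in> schwartz \<Longrightarrow> p h \<le> K * (\<Sum>(\<alpha>, is)\<in>B. schwartz_seminorm \<alpha> is h)"
    using p unfolding seminorm_dominated_def by blast
  \<comment> \<open>The summand \<open>1\<close> keeps the denominator positive when \<open>K = 0\<close> or \<open>B\<close> is empty, and makes the
    final inequality strict.\<close>
  define \<delta> where "\<delta> = r / (K * card B + 1)"
  have pos: "0 < K * card B + 1"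
    using K by (simp add: add_nonneg_pos)
  then have \<delta>: "0 < \<delta>"
    using r by (simp add: \<delta>_def)
  define N where "N = (\<Inter>b\<in>B. {g \<in> schwartz. schwartz_seminorm (fst b) (snd b) (\<lambda>x. g x - f x) < \<delta>})
    \<inter> topspace schwartz_topology"
  have "openin schwartz_topology N"
    unfolding N_def by (intro openin_INT B openin_schwartz_seminorm_ball f \<delta>)
  moreover have "f \<in> N"
    using f \<delta> by (auto simp: N_def schwartz_seminorm_zero)
  moreover have "p (\<lambda>x. g x - f x) < r" if g: "g \<in> N" for g
  proof -
    have gS: "g \<in> schwartz" using g by (simp add: N_def)
    have "(\<Sum>(\<alpha>, is)\<in>B. schwartz_seminorm \<alpha> is (\<lambda>x. g x - f x)) \<le> (\<Sum>b\<in>B. \<delta>)"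
      using g by (intro sum_mono) (force simp: N_def)
    then have "K * (\<Sum>(\<alpha>, is)\<in>B. schwartz_seminorm \<alpha> is (\<lambda>x. g x - f x)) \<le> K * (card B * \<delta>)"
      using K by (intro mult_left_mono) auto
    moreover have "K * (card B * \<delta>) < r"
    proof -
      have "(K * card B + 1) * \<delta> = r" using pos by (simp add: \<delta>_def)
      then show ?thesis using \<delta> by (simp add: algebra_simps)
    qed
    ultimately show ?thesis
      using le[OF schwartz_diff[OF gS f]] by linarith
  qed
  ultimately show ?thesis by blast
qed

text \<open>
  The subbasic balls have arbitrary centres \<open>h\<close>. Additivity of \<open>T\<close> reduces them to a bound at the
  origin: \<open>T g - h = T (g - f) + (T f - h)\<close>, and the second summand already lies strictly inside the
  ball, which leaves room for the first one.
\<close>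
lemma continuous_map_schwartz:
  fixes T :: "(real ^ 'n::finite \<Rightarrow> complex) \<Rightarrow> real ^ 'm::finite \<Rightarrow> complex"
  assumes T: "\<And>f. f \<in> schwartz \<Longrightarrow> T f \<in> schwartz"
    and diff: "\<And>f g. f \<in> schwartz \<Longrightarrow> g \<in> schwartz \<Longrightarrow> T (\<lambda>x. f x - g x) = (\<lambda>x. T f x - T g x)"
    and dom: "\<And>\<alpha> is. seminorm_dominated (\<lambda>f. schwartz_seminorm \<alpha> is (T f))"
  shows "continuous_map schwartz_topology schwartz_topology T"
proof -
  have "openin schwartz_topology
      (T -` {g \<in> schwartz. schwartz_seminorm \<alpha> is (\<lambda>x. g x - h x) < e} \<inter> schwartz)" (is "openin _ ?U")
    if h: "h \<in> schwartz" for \<alpha> "is" h e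
  proof (subst openin_subopen, intro ballI)
    fix f assume "f \<in> ?U"
    then have f: "f \<in> schwartz" and fe: "schwartz_seminorm \<alpha> is (\<lambda>x. T f x - h x) < e"
      by auto
    obtain N where N: "openin schwartz_topology N" "f \<in> N"
      and Nb: "\<And>g. g \<in> N \<Longrightarrow>
        schwartz_seminorm \<alpha> is (T (\<lambda>x. g x - f x)) < e - schwartz_seminorm \<alpha> is (\<lambda>x. T f x - h x)"
      using seminorm_dominated_nbhd[OF dom f, of "e - schwartz_seminorm \<alpha> is (\<lambda>x. T f x - h x)" \<alpha> "is"] fe
      by auto
    have "N \<subseteq> ?U"
    proof
      fix g assume g: "g \<in> N"
      then have gS: "g \<in> schwartz"
        using openin_subset[OF N(1)] by auto
      have "schwartz_seminorm \<alpha> is (\<lambda>x. T (\<lambda>x. g x - f x) x + (T f x - h x))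
          \<le> schwartz_seminorm \<alpha> is (T (\<lambda>x. g x - f x)) + schwartz_seminorm \<alpha> is (\<lambda>x. T f x - h x)"
        by (intro schwartz_seminorm_add schwartz_diff T gS f h)
      also have "(\<lambda>x. T (\<lambda>x. g x - f x) x + (T f x - h x)) = (\<lambda>x. T g x - h x)"
        by (simp add: diff[OF gS f])
      finally show "g \<in> ?U"
        using Nb[OF g] gS T[OF gS] by simp
    qed
    then show "\<exists>N. openin schwartz_topology N \<and> f \<in> N \<and> N \<subseteq> ?U"
      using N by blast
  qed
  moreover have "T ` schwartz \<subseteq> topspace schwartz_topology"
    using T by auto
  ultimately show ?thesis
    unfolding schwartz_topology_def[where 'n = 'm] continuous_on_generated_topo_iff
    by (auto simp: topology_generated_by_topspace)
qed


section \<open>Moments\<close>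

lemma norm_mono_fun: "norm (mono_fun \<gamma> x) = (\<Prod>i\<in>UNIV. \<bar>x $ i\<bar> ^ \<gamma> i)"
  by (simp add: mono_fun_def norm_power flip: prod_norm)

lemma continuous_on_mono_fun: "continuous_on UNIV (mono_fun \<gamma>)"
  unfolding mono_fun_def by (intro continuous_intros)

lemma schwartz_continuous: "f \<in> schwartz \<Longrightarrow> continuous_on UNIV f"
  using differentiable_imp_continuous_within
  by (fastforce simp: schwartz_def smooth_def continuous_on_eq_continuous_within dest: spec[of _ "[]"])

text \<open>
  The weight is a product of functions of one coordinate each, so by Tonelli its integral is a power
  of the finite integral of \<open>1 / (1 + t\<^sup>2)\<close> over the line.
\<close>
lemma integrable_inverse_prod_1_plus_square:
  "integrable lborel (\<lambda>x :: real ^ 'n::finite. inverse (\<Prod>i\<in>UNIV. 1 + (x $ i)\<^sup>2))"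
proof -
  have "integrable lborel (\<lambda>x :: real. inverse (1 + x\<^sup>2))"
    using integrable_inverse_1_plus_square by (simp add: set_integrable_def)
  then have fin: "(\<integral>\<^sup>+x. ennreal (inverse (1 + x\<^sup>2)) \<partial>lborel) < \<infinity>"
    by (subst (asm) integrable_iff_bounded) simp
  have prod: "(\<Prod>i\<in>UNIV. 1 + (x $ i)\<^sup>2) = (\<Prod>b\<in>Basis. 1 + (x \<bullet> b)\<^sup>2)" for x :: "real ^ 'n"
    by (simp add: Basis_vec_def axis_eq_axis UNION_singleton_eq_range prod.reindex inj_on_def
        cart_eq_inner_axis)
  have "(\<integral>\<^sup>+x. (\<Prod>b\<in>Basis. ennreal (inverse (1 + (x \<bullet> b)\<^sup>2))) \<partial>(lborel :: (real ^ 'n) measure))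
      = (\<Prod>b\<in>(Basis :: (real ^ 'n) set). \<integral>\<^sup>+x. ennreal (inverse (1 + x\<^sup>2)) \<partial>lborel)"
    by (intro nn_integral_lborel_prod) auto
  also have "\<dots> < \<infinity>"
    using fin by (simp add: ennreal_prod_eq_top less_top[symmetric] del: prod_constant)
  finally have "(\<integral>\<^sup>+x. ennreal (inverse (\<Prod>b\<in>Basis. 1 + (x \<bullet> b)\<^sup>2)) \<partial>(lborel :: (real ^ 'n) measure)) < \<infinity>"
    by (simp add: prod_ennreal prod_inversef[unfolded o_def])
  then show ?thesis
    unfolding prod integrable_iff_bounded
    by (auto simp: abs_of_nonneg prod_nonneg)
qed

text \<open>
  Multiplied out, the weight \<open>\<Prod>\<^sub>i (1 + x\<^sub>i\<^sup>2)\<close> is the sum over all sets \<open>S\<close> of coordinates of the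
  monomials \<open>\<Prod>\<^bsub>i\<in>S\<^esub> x\<^sub>i\<^sup>2\<close>. Each product of such a monomial with \<open>x\<^sup>\<gamma> \<phi>(x)\<close> is controlled by a single
  Schwartz seminorm. This is what makes a product weight more convenient than a power of
  \<open>1 + \<bar>x\<bar>\<^sup>2\<close>.
\<close>
lemma schwartz_weighted_decay:
  fixes \<phi> :: "real ^ 'n::finite \<Rightarrow> complex"
  assumes \<phi>: "\<phi> \<in> schwartz"
  shows "norm (mono_fun \<gamma> x * \<phi> x) \<le>
    (\<Sum>S\<in>UNIV. schwartz_seminorm (\<lambda>i. \<gamma> i + (if i \<in> S then 2 else 0)) [] \<phi>) *
      inverse (\<Prod>i\<in>UNIV. 1 + (x $ i)\<^sup>2)"
proof -
  have bound: "(\<Prod>i\<in>S. (x $ i)\<^sup>2) * norm (mono_fun \<gamma> x * \<phi> x)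
      \<le> schwartz_seminorm (\<lambda>i. \<gamma> i + (if i \<in> S then 2 else 0)) [] \<phi>" for S
  proof -
    have "(\<Prod>i\<in>S. (x $ i)\<^sup>2) = (\<Prod>i\<in>UNIV. \<bar>x $ i\<bar> ^ (if i \<in> S then 2 else 0))"
      using prod.inter_restrict[of UNIV "\<lambda>i. (x $ i)\<^sup>2" S] by (auto intro!: prod.cong)
    then have "(\<Prod>i\<in>S. (x $ i)\<^sup>2) * norm (mono_fun \<gamma> x * \<phi> x)
        = norm (mono_fun (\<lambda>i. \<gamma> i + (if i \<in> S then 2 else 0)) x * partials [] \<phi> x)"
      by (simp add: norm_mult norm_mono_fun power_add prod.distrib)
    then show ?thesis
      using schwartz_seminorm_upper[OF \<phi>] by metis
  qed
  have "(\<Prod>i\<in>UNIV. 1 + (x $ i)\<^sup>2) = (\<Sum>S\<in>UNIV. \<Prod>i\<in>S. (x $ i)\<^sup>2)"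
    using prod_add[of UNIV "\<lambda>i. (x $ i)\<^sup>2" "\<lambda>i. 1"] by (simp add: add.commute)
  then have "(\<Prod>i\<in>UNIV. 1 + (x $ i)\<^sup>2) * norm (mono_fun \<gamma> x * \<phi> x)
      \<le> (\<Sum>S\<in>UNIV. schwartz_seminorm (\<lambda>i. \<gamma> i + (if i \<in> S then 2 else 0)) [] \<phi>)"
    by (simp only: sum_distrib_right) (intro sum_mono bound)
  moreover have "0 < (\<Prod>i\<in>UNIV. 1 + (x $ i)\<^sup>2)"
    by (intro prod_pos) (simp add: add_pos_nonneg)
  ultimately show ?thesis
    by (simp add: field_simps)
qed

definition moment :: "('n::finite \<Rightarrow> nat) \<Rightarrow> (real ^ 'n \<Rightarrow> complex) \<Rightarrow> complex" where
  "moment \<gamma> \<phi> = (LINT x|lborel. mono_fun \<gamma> x * \<phi> x)"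

lemma integrable_moment:
  fixes \<phi> :: "real ^ 'n::finite \<Rightarrow> complex"
  assumes \<phi>: "\<phi> \<in> schwartz"
  shows "integrable lborel (\<lambda>x. mono_fun \<gamma> x * \<phi> x)"
proof (rule Bochner_Integration.integrable_bound)
  show "integrable lborel (\<lambda>x :: real ^ 'n.
      (\<Sum>S\<in>UNIV. schwartz_seminorm (\<lambda>i. \<gamma> i + (if i \<in> S then 2 else 0)) [] \<phi>) *
      inverse (\<Prod>i\<in>UNIV. 1 + (x $ i)\<^sup>2))"
    by (intro integrable_mult_right integrable_inverse_prod_1_plus_square)
  have "(\<lambda>x. mono_fun \<gamma> x * \<phi> x) \<in> borel_measurable borel"
    by (intro borel_measurable_continuous_onI continuous_on_mult continuous_on_mono_fun schwartz_continuous \<phi>)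
  then show "(\<lambda>x. mono_fun \<gamma> x * \<phi> x) \<in> borel_measurable lborel"
    by simp
qed (use schwartz_weighted_decay[OF \<phi>] in \<open>auto intro: order_trans[OF _ abs_ge_self]\<close>)

lemma linear_form_on_moment: "linear_form_on schwartz (moment \<gamma>)"
  unfolding linear_form_on_def moment_def
proof (intro conjI ballI allI)
  fix f g :: "real ^ 'a \<Rightarrow> complex" and c :: complex
  assume f: "f \<in> schwartz"
  have "(LINT x|lborel. mono_fun \<gamma> x * (c * f x)) = (LINT x|lborel. c * (mono_fun \<gamma> x * f x))"
    by (simp only: mult.left_commute)
  then show "(LINT x|lborel. mono_fun \<gamma> x * (c * f x)) = c * (LINT x|lborel. mono_fun \<gamma> x * f x)"
    by simp
  assume g: "g \<in> schwartz"
  show "(LINT x|lborel. mono_fun \<gamma> x * (f x + g x))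
      = (LINT x|lborel. mono_fun \<gamma> x * f x) + (LINT x|lborel. mono_fun \<gamma> x * g x)"
    using integrable_moment[OF f] integrable_moment[OF g] by (simp add: distrib_left)
qed

lemma seminorm_dominated_moment: "seminorm_dominated (\<lambda>\<phi>. norm (moment \<gamma> \<phi>))"
proof (rule seminorm_dominated_mono)
  let ?w = "\<lambda>x :: real ^ 'a. inverse (\<Prod>i\<in>UNIV. 1 + (x $ i)\<^sup>2)"
  let ?s = "\<lambda>\<phi> S. schwartz_seminorm (\<lambda>i. \<gamma> i + (if i \<in> S then 2 else 0)) [] \<phi>"
  show "seminorm_dominated (\<lambda>\<phi>. (\<Sum>S\<in>UNIV. ?s \<phi> S) * (LINT x|lborel. ?w x))"
    by (intro seminorm_dominated_scale seminorm_dominated_sum seminorm_dominated_seminorm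
        integral_nonneg_AE AE_I2) (auto intro!: prod_nonneg)
  fix \<phi> :: "real ^ 'a \<Rightarrow> complex"
  assume \<phi>: "\<phi> \<in> schwartz"
  have "norm (moment \<gamma> \<phi>) \<le> (LINT x|lborel. (\<Sum>S\<in>UNIV. ?s \<phi> S) * ?w x)"
    unfolding moment_def
    by (intro Bochner_Integration.integral_norm_bound_integral integrable_moment \<phi> integrable_mult_right
        integrable_inverse_prod_1_plus_square schwartz_weighted_decay)
  then show "norm (moment \<gamma> \<phi>) \<le> (\<Sum>S\<in>UNIV. ?s \<phi> S) * (LINT x|lborel. ?w x)"
    by simp
qed

lemma schwartz_moment_eq:
  "schwartz_moment l = joint_kernel schwartz {\<gamma>. multi_deg \<gamma> \<le> l} moment"
  by (auto simp: schwartz_moment_def joint_kernel_def moment_def)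

lemma distr_of_poly:
  assumes "\<phi> \<in> schwartz"
  shows "distr_of_fun (\<lambda>x. \<Sum>\<gamma> | multi_deg \<gamma> \<le> l. a \<gamma> * mono_fun \<gamma> x) \<phi>
    = (\<Sum>\<gamma> | multi_deg \<gamma> \<le> l. a \<gamma> * moment \<gamma> \<phi>)"
  using assms integrable_moment[OF assms]
  by (simp add: distr_of_fun_def restrict_functional_def moment_def sum_distrib_right mult.assoc)


section \<open>Restriction and extension\<close>

text \<open>
  The continuity statement includes that the values of the projection have vanishing moments, since
  a continuous map sends the one topological space into the other.
\<close>
lemma moment_projection:
  obtains e :: "('n::finite \<Rightarrow> nat) \<Rightarrow> real ^ 'n \<Rightarrow> complex"
  where "\<And>\<gamma>. multi_deg \<gamma> \<le> l \<Longrightarrow> e \<gamma> \<in> schwartz"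
    and "continuous_map schwartz_topology (schwartz_moment_topology l)
      (\<lambda>\<phi> x. \<phi> x - (\<Sum>\<gamma> | multi_deg \<gamma> \<le> l. moment \<gamma> \<phi> * e \<gamma> x))"
proof -
  let ?I = "{\<gamma> :: 'n \<Rightarrow> nat. multi_deg \<gamma> \<le> l}"
  obtain e :: "('n \<Rightarrow> nat) \<Rightarrow> real ^ 'n \<Rightarrow> complex" where eS: "\<And>\<gamma>. \<gamma> \<in> ?I \<Longrightarrow> e \<gamma> \<in> schwartz"
    and e: "\<And>\<phi>. \<phi> \<in> schwartz \<Longrightarrow>
      (\<lambda>x. \<phi> x - (\<Sum>\<gamma>\<in>?I. moment \<gamma> \<phi> * e \<gamma> x)) \<in> joint_kernel schwartz ?I moment"
    using joint_kernel_complement[OF function_subspace_schwartz finite_multi_deg_le, of l moment]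
      linear_form_on_moment by blast
  define P where "P = (\<lambda>\<phi> x. \<phi> x - (\<Sum>\<gamma>\<in>?I. moment \<gamma> \<phi> * e \<gamma> x))"
  have PK: "P \<phi> \<in> schwartz_moment l" if "\<phi> \<in> schwartz" for \<phi>
    using e[OF that] by (simp add: schwartz_moment_eq P_def)
  then have PS: "P \<phi> \<in> schwartz" if "\<phi> \<in> schwartz" for \<phi>
    using that by (auto simp: schwartz_moment_def)
  have "continuous_map schwartz_topology schwartz_topology P"
  proof (rule continuous_map_schwartz[OF PS])
    show "P (\<lambda>x. f x - g x) = (\<lambda>x. P f x - P g x)" if "f \<in> schwartz" "g \<in> schwartz" for f g
      unfolding P_def linear_form_on_diff[OF function_subspace_schwartz linear_form_on_moment that]
      by (simp add: left_diff_distrib sum_subtractf) (simp add: algebra_simps)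
    show "seminorm_dominated (\<lambda>f. schwartz_seminorm \<alpha> is (P f))" for \<alpha> "is"
    proof (rule seminorm_dominated_mono)
      show "seminorm_dominated (\<lambda>\<phi>. schwartz_seminorm \<alpha> is \<phi> +
          (\<Sum>\<gamma>\<in>?I. norm (moment \<gamma> \<phi>) * schwartz_seminorm \<alpha> is (e \<gamma>)))"
        by (intro seminorm_dominated_add seminorm_dominated_sum finite_multi_deg_le
            seminorm_dominated_scale seminorm_dominated_moment schwartz_seminorm_nonneg eS
            seminorm_dominated_seminorm)
      fix \<phi> :: "real ^ 'n \<Rightarrow> complex"
      assume \<phi>: "\<phi> \<in> schwartz"
      have "schwartz_seminorm \<alpha> is (\<lambda>x. \<phi> x + (\<Sum>\<gamma>\<in>?I. - moment \<gamma> \<phi> * e \<gamma> x))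
          \<le> schwartz_seminorm \<alpha> is \<phi> + (\<Sum>\<gamma>\<in>?I. norm (- moment \<gamma> \<phi>) * schwartz_seminorm \<alpha> is (e \<gamma>))"
        by (intro order_trans[OF schwartz_seminorm_add] add_mono schwartz_seminorm_lincomb
            schwartz_lincomb finite_multi_deg_le eS \<phi> order_refl)
      then show "schwartz_seminorm \<alpha> is (P \<phi>) \<le> schwartz_seminorm \<alpha> is \<phi> +
          (\<Sum>\<gamma>\<in>?I. norm (moment \<gamma> \<phi>) * schwartz_seminorm \<alpha> is (e \<gamma>))"
        by (simp add: P_def sum_negf)
    qed
  qed
  then have "continuous_map schwartz_topology (schwartz_moment_topology l) P"
    using PK by (auto simp: schwartz_moment_topology_def continuous_map_in_subtopology)
  then show ?thesis
    using that[of e] eS by (simp add: P_def)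
qed

lemma function_subspace_schwartz_moment: "function_subspace (schwartz_moment l)"
  unfolding function_subspace_def schwartz_moment_eq joint_kernel_def
  using linear_form_on_scale[OF linear_form_on_moment schwartz_zero, of _ 0]
  by (auto simp: schwartz_zero schwartz_add schwartz_scale
      linear_form_on_add[OF linear_form_on_moment] linear_form_on_scale[OF linear_form_on_moment])

lemma continuous_dual_iff:
  "u \<in> continuous_dual T \<longleftrightarrow> linear_form_on (topspace T) u \<and> continuous_map T euclidean u \<and>
     (\<forall>\<phi>. \<phi> \<notin> topspace T \<longrightarrow> u \<phi> = 0)"
  by (simp add: continuous_dual_def linear_form_on_def)

lemma continuous_dual_add:
  "u \<in> continuous_dual T \<Longrightarrow> v \<in> continuous_dual T \<Longrightarrow> (\<lambda>\<phi>. u \<phi> + v \<phi>) \<in> continuous_dual T"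
  by (auto simp: continuous_dual_def algebra_simps intro!: continuous_map_add)

lemma continuous_dual_scale:
  "u \<in> continuous_dual T \<Longrightarrow> (\<lambda>\<phi>. c * u \<phi>) \<in> continuous_dual T"
  by (auto simp: continuous_dual_def algebra_simps continuous_map_atin intro!: tendsto_mult_left)

lemma restrict_functional_eq_iff:
  "restrict_functional X u = restrict_functional X v \<longleftrightarrow> (\<forall>\<phi>\<in>X. u \<phi> = v \<phi>)"
  by (auto simp: restrict_functional_def fun_eq_iff)

lemma restrict_functional_add:
  "restrict_functional X (\<lambda>\<phi>. u \<phi> + v \<phi>) =
    (\<lambda>\<phi>. restrict_functional X u \<phi> + restrict_functional X v \<phi>)"
  by (auto simp: restrict_functional_def)

lemma restrict_functional_scale:
  "restrict_functional X (\<lambda>\<phi>. c * u \<phi>) = (\<lambda>\<phi>. c * restrict_functional X u \<phi>)"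
  by (auto simp: restrict_functional_def)

text \<open>
  Such a \<open>w\<close> does not see the projection of \<open>\<phi>\<close> onto the joint kernel, hence it depends on \<open>\<phi>\<close> only
  through the moments; the values \<open>w (e \<gamma>)\<close> are the coefficients of the polynomial.
\<close>
lemma annihilator_schwartz_moment:
  fixes w :: "(real ^ 'n::finite \<Rightarrow> complex) \<Rightarrow> complex"
  assumes w: "w \<in> tempered" and zero: "\<And>\<phi>. \<phi> \<in> schwartz_moment l \<Longrightarrow> w \<phi> = 0"
  shows "w \<in> distr_of_fun ` polys_le l"
proof -
  let ?I = "{\<gamma> :: 'n \<Rightarrow> nat. multi_deg \<gamma> \<le> l}"
  obtain e :: "('n \<Rightarrow> nat) \<Rightarrow> real ^ 'n \<Rightarrow> complex" where eS: "\<And>\<gamma>. multi_deg \<gamma> \<le> l \<Longrightarrow> e \<gamma> \<in> schwartz"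
    and cont: "continuous_map schwartz_topology (schwartz_moment_topology l)
      (\<lambda>\<phi> x. \<phi> x - (\<Sum>\<gamma>\<in>?I. moment \<gamma> \<phi> * e \<gamma> x))"
    using moment_projection[of l] by blast
  have lin: "linear_form_on schwartz w" and out: "\<And>\<phi>. \<phi> \<notin> schwartz \<Longrightarrow> w \<phi> = 0"
    using w by (auto simp: tempered_def continuous_dual_iff)
  have "w \<phi> = distr_of_fun (\<lambda>x. \<Sum>\<gamma>\<in>?I. w (e \<gamma>) * mono_fun \<gamma> x) \<phi>" for \<phi>
  proof (cases "\<phi> \<in> schwartz")
    case True
    let ?\<psi> = "\<lambda>x. \<Sum>\<gamma>\<in>?I. moment \<gamma> \<phi> * e \<gamma> x"
    have \<psi>: "?\<psi> \<in> schwartz"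
      using eS by (intro schwartz_lincomb finite_multi_deg_le) auto
    have "(\<lambda>x. \<phi> x - ?\<psi> x) \<in> schwartz_moment l"
      using continuous_map_funspace[OF cont] True by auto
    then have "w \<phi> = w ?\<psi>"
      using zero linear_form_on_diff[OF function_subspace_schwartz lin True \<psi>] by simp
    also have "\<dots> = (\<Sum>\<gamma>\<in>?I. moment \<gamma> \<phi> * w (e \<gamma>))"
      using eS by (intro linear_form_on_lincomb[OF function_subspace_schwartz lin] finite_multi_deg_le) auto
    also have "\<dots> = (\<Sum>\<gamma>\<in>?I. w (e \<gamma>) * moment \<gamma> \<phi>)"
      by (simp add: mult.commute)
    finally show ?thesis
      by (simp add: distr_of_poly[OF True])
  next
    case False
    then show ?thesis by (simp add: out distr_of_fun_def restrict_functional_def)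
  qed
  then have "w = distr_of_fun (\<lambda>x. \<Sum>\<gamma>\<in>?I. w (e \<gamma>) * mono_fun \<gamma> x)"
    by (rule ext)
  moreover have "(\<lambda>x. \<Sum>\<gamma>\<in>?I. w (e \<gamma>) * mono_fun \<gamma> x) \<in> polys_le l"
    unfolding polys_le_def mem_Collect_eq by (rule exI) (rule refl)
  ultimately show ?thesis
    by (rule image_eqI)
qed

text \<open>
  The relation is the kernel of the restriction map. That it is an equivalence relation and that
  restriction is well defined and injective on its classes are formal consequences.
\<close>
lemma poly_rel_iff_restrict_eq:
  "(u, v) \<in> poly_rel l \<longleftrightarrow> u \<in> tempered \<and> v \<in> tempered \<and>
     restrict_functional (schwartz_moment l) u = restrict_functional (schwartz_moment l) v"
proof -
  have "(\<lambda>\<phi>. u \<phi> - v \<phi>) \<in> distr_of_fun ` polys_le l \<longleftrightarrow> (\<forall>\<phi>\<in>schwartz_moment l. u \<phi> = v \<phi>)"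
    if "u \<in> tempered" "v \<in> tempered"
  proof
    assume "(\<lambda>\<phi>. u \<phi> - v \<phi>) \<in> distr_of_fun ` polys_le l"
    then obtain a where a: "(\<lambda>\<phi>. u \<phi> - v \<phi>) = distr_of_fun (\<lambda>x. \<Sum>\<gamma> | multi_deg \<gamma> \<le> l. a \<gamma> * mono_fun \<gamma> x)"
      by (auto simp: polys_le_def)
    show "\<forall>\<phi>\<in>schwartz_moment l. u \<phi> = v \<phi>"
    proof
      fix \<phi> :: "real ^ 'a \<Rightarrow> complex"
      assume "\<phi> \<in> schwartz_moment l"
      then have "\<phi> \<in> schwartz" "\<And>\<gamma>. multi_deg \<gamma> \<le> l \<Longrightarrow> moment \<gamma> \<phi> = 0"
        by (auto simp: schwartz_moment_eq joint_kernel_def)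
      then show "u \<phi> = v \<phi>"
        using fun_cong[OF a, of \<phi>] by (simp add: distr_of_poly)
    qed
  next
    assume "\<forall>\<phi>\<in>schwartz_moment l. u \<phi> = v \<phi>"
    moreover have "(\<lambda>\<phi>. u \<phi> - v \<phi>) \<in> tempered"
      using continuous_dual_add[of u _ "\<lambda>\<phi>. (-1) * v \<phi>"] continuous_dual_scale[of v _ "-1"] that
      by (simp add: tempered_def)
    ultimately show "(\<lambda>\<phi>. u \<phi> - v \<phi>) \<in> distr_of_fun ` polys_le l"
      by (intro annihilator_schwartz_moment) auto
  qed
  then show ?thesis
    by (auto simp: poly_rel_def restrict_functional_eq_iff)
qed

lemma equiv_poly_rel: "equiv tempered (poly_rel l)"
proof (rule equivI)
  show "poly_rel l \<subseteq> tempered \<times> tempered"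
    by (auto simp: poly_rel_def)
  show "refl_on tempered (poly_rel l)"
    by (rule refl_onI) (simp add: poly_rel_iff_restrict_eq)
  show "sym (poly_rel l)"
    by (rule symI) (simp add: poly_rel_iff_restrict_eq)
  show "trans (poly_rel l)"
    by (rule transI) (simp add: poly_rel_iff_restrict_eq)
qed

lemma restrict_tempered:
  assumes "u \<in> tempered"
  shows "restrict_functional (schwartz_moment l) u \<in> continuous_dual (schwartz_moment_topology l)"
proof -
  let ?r = "restrict_functional (schwartz_moment l) u"
  have lin: "linear_form_on schwartz u" and cont: "continuous_map schwartz_topology euclidean u"
    using assms by (auto simp: tempered_def continuous_dual_iff)
  have "continuous_map (schwartz_moment_topology l) euclidean u"
    unfolding schwartz_moment_topology_def by (rule continuous_map_from_subtopology[OF cont])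
  then have "continuous_map (schwartz_moment_topology l) euclidean ?r"
    by (rule continuous_map_eq) (simp add: restrict_functional_def)
  moreover have "linear_form_on (schwartz_moment l) ?r"
  proof -
    have "\<phi> \<in> schwartz" if "\<phi> \<in> schwartz_moment l" for \<phi> :: "real ^ 'a \<Rightarrow> complex"
      using that by (simp add: schwartz_moment_def)
    then show ?thesis
      unfolding linear_form_on_def
      by (simp add: restrict_functional_def function_subspace_add[OF function_subspace_schwartz_moment]
          function_subspace_scale[OF function_subspace_schwartz_moment]
          linear_form_on_add[OF lin] linear_form_on_scale[OF lin])
  qed
  ultimately show ?thesis
    by (simp add: continuous_dual_iff restrict_functional_def)
qed

text \<open>The extension is \<open>v \<circ> P\<close> for the moment projection \<open>P\<close>, which fixes the joint kernel.\<close>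
lemma extend_to_tempered:
  fixes v :: "(real ^ 'n::finite \<Rightarrow> complex) \<Rightarrow> complex"
  assumes v: "v \<in> continuous_dual (schwartz_moment_topology l)"
  obtains u where "u \<in> tempered" "restrict_functional (schwartz_moment l) u = v"
proof -
  let ?I = "{\<gamma> :: 'n \<Rightarrow> nat. multi_deg \<gamma> \<le> l}"
  obtain e :: "('n \<Rightarrow> nat) \<Rightarrow> real ^ 'n \<Rightarrow> complex" where
    cont: "continuous_map schwartz_topology (schwartz_moment_topology l)
      (\<lambda>\<phi> x. \<phi> x - (\<Sum>\<gamma>\<in>?I. moment \<gamma> \<phi> * e \<gamma> x))"
    using moment_projection[of l] by blast
  define P where "P = (\<lambda>\<phi> x. \<phi> x - (\<Sum>\<gamma>\<in>?I. moment \<gamma> \<phi> * e \<gamma> x))"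
  have P: "P \<phi> \<in> schwartz_moment l" if "\<phi> \<in> schwartz" for \<phi>
    using continuous_map_funspace[OF cont] that by (auto simp: P_def)
  have P_add: "P (\<lambda>x. f x + g x) = (\<lambda>x. P f x + P g x)" if "f \<in> schwartz" "g \<in> schwartz" for f g
    unfolding P_def linear_form_on_add[OF linear_form_on_moment that]
    by (simp add: distrib_right sum.distrib) (simp add: algebra_simps)
  have P_scale: "P (\<lambda>x. c * f x) = (\<lambda>x. c * P f x)" if "f \<in> schwartz" for c f
    unfolding P_def linear_form_on_scale[OF linear_form_on_moment that]
    by (simp add: right_diff_distrib sum_distrib_left mult.assoc)
  have lin: "linear_form_on (schwartz_moment l) v" and vc: "continuous_map (schwartz_moment_topology l) euclidean v"
    and out: "\<And>\<phi>. \<phi> \<notin> schwartz_moment l \<Longrightarrow> v \<phi> = 0"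
    using v by (auto simp: continuous_dual_iff)
  define u where "u = restrict_functional schwartz (\<lambda>\<phi>. v (P \<phi>))"
  have "continuous_map schwartz_topology euclidean (v \<circ> P)"
    using cont vc by (intro continuous_map_compose) (auto simp: P_def)
  then have "continuous_map schwartz_topology euclidean u"
    by (rule continuous_map_eq) (simp add: u_def restrict_functional_def)
  moreover have "linear_form_on schwartz u"
    using lin P by (auto simp: linear_form_on_def u_def restrict_functional_def schwartz_add schwartz_scale P_add P_scale)
  ultimately have "u \<in> tempered"
    by (simp add: tempered_def continuous_dual_iff u_def restrict_functional_def)
  moreover have "restrict_functional (schwartz_moment l) u = v"
  proof
    fix \<phi>
    show "restrict_functional (schwartz_moment l) u \<phi> = v \<phi>"
    proof (cases "\<phi> \<in> schwartz_moment l")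
      case True
      then have "P \<phi> = \<phi>" "\<phi> \<in> schwartz"
        by (auto simp: P_def schwartz_moment_eq joint_kernel_def)
      then show ?thesis using True by (simp add: u_def restrict_functional_def)
    qed (simp add: restrict_functional_def out)
  qed
  ultimately show ?thesis using that by blast
qed

theorem proposition2p4:
  fixes l :: nat
  shows "equiv (tempered :: ((real ^ 'n::finite \<Rightarrow> complex) \<Rightarrow> complex) set) (poly_rel l) \<and>
    (\<exists>\<Phi> :: ((real ^ 'n \<Rightarrow> complex) \<Rightarrow> complex) set \<Rightarrow> (real ^ 'n \<Rightarrow> complex) \<Rightarrow> complex.
      (\<forall>u\<in>tempered. \<Phi> (poly_rel l `` {u}) = restrict_functional (schwartz_moment l) u) \<and>
      (\<forall>C\<in>tempered_mod l. \<forall>D\<in>tempered_mod l.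
         \<Phi> (quot_add l C D) = (\<lambda>\<phi>. \<Phi> C \<phi> + \<Phi> D \<phi>)) \<and>
      (\<forall>c. \<forall>C\<in>tempered_mod l. \<Phi> (quot_scale l c C) = (\<lambda>\<phi>. c * \<Phi> C \<phi>)) \<and>
      bij_betw \<Phi> (tempered_mod l) (continuous_dual (schwartz_moment_topology l)))"
proof (intro conjI exI)
  let ?T = "tempered :: ((real ^ 'n \<Rightarrow> complex) \<Rightarrow> complex) set"
  let ?R = "restrict_functional (schwartz_moment l :: (real ^ 'n \<Rightarrow> complex) set)"
  let ?cl = "\<lambda>u :: (real ^ 'n \<Rightarrow> complex) \<Rightarrow> complex. poly_rel l `` {u}"
  define \<Phi> where "\<Phi> = (\<lambda>C. ?R (SOME u. u \<in> C))"
  show eq: "equiv ?T (poly_rel l)"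
    by (rule equiv_poly_rel)
  have cl_eq: "?cl u = ?cl v" if "u \<in> ?T" "v \<in> ?T" "?R u = ?R v" for u v
    using that by (intro equiv_class_eq[OF eq]) (simp add: poly_rel_iff_restrict_eq)
  have self: "u \<in> ?cl u" if "u \<in> ?T" for u
    by (rule equiv_class_self[OF eq that])
  have cl_D: "u' \<in> ?T" "?R u' = ?R u" if "u' \<in> ?cl u" for u u'
    using that by (simp_all add: poly_rel_iff_restrict_eq)
  have \<Phi>: "\<Phi> (?cl u) = ?R u" if "u \<in> ?T" for u
  proof -
    have "(SOME v. v \<in> ?cl u) \<in> ?cl u"
      using self[OF that] by (rule someI[of "\<lambda>v. v \<in> ?cl u"])
    then show ?thesis
      unfolding \<Phi>_def by (rule cl_D(2))
  qed
  then show "\<forall>u\<in>?T. \<Phi> (?cl u) = ?R u" by blast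
  have plus: "(\<lambda>\<phi>. u \<phi> + v \<phi>) \<in> ?T" if "u \<in> ?T" "v \<in> ?T" for u v
    using that by (simp add: tempered_def continuous_dual_add)
  have times: "(\<lambda>\<phi>. c * u \<phi>) \<in> ?T" if "u \<in> ?T" for c u
    using that by (simp add: tempered_def continuous_dual_scale)
  have class_obtains: "\<exists>u. u \<in> ?T \<and> C = ?cl u" if "C \<in> tempered_mod l" for C
    using that unfolding tempered_mod_def by (rule quotientE) blast
  have add: "quot_add l (?cl u) (?cl v) = ?cl (\<lambda>\<phi>. u \<phi> + v \<phi>)" if u: "u \<in> ?T" and v: "v \<in> ?T" for u v
  proof -
    have "?cl (\<lambda>\<phi>. u' \<phi> + v' \<phi>) = ?cl (\<lambda>\<phi>. u \<phi> + v \<phi>)" if "u' \<in> ?cl u" "v' \<in> ?cl v" for u' v'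
      by (intro cl_eq plus u v cl_D(1)[OF that(1)] cl_D(1)[OF that(2)])
        (simp only: restrict_functional_add cl_D(2)[OF that(1)] cl_D(2)[OF that(2)])
    then have "quot_add l (?cl u) (?cl v) = (\<Union>u'\<in>?cl u. \<Union>v'\<in>?cl v. ?cl (\<lambda>\<phi>. u \<phi> + v \<phi>))"
      unfolding quot_add_def by (intro SUP_cong refl)
    also have "\<dots> = ?cl (\<lambda>\<phi>. u \<phi> + v \<phi>)"
      unfolding UN_constant using self[OF u] self[OF v] by (metis empty_iff)
    finally show ?thesis .
  qed
  have scale: "quot_scale l c (?cl u) = ?cl (\<lambda>\<phi>. c * u \<phi>)" if u: "u \<in> ?T" for c u
  proof -
    have "?cl (\<lambda>\<phi>. c * u' \<phi>) = ?cl (\<lambda>\<phi>. c * u \<phi>)" if "u' \<in> ?cl u" for u'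
      by (intro cl_eq times u cl_D(1)[OF that]) (simp only: restrict_functional_scale cl_D(2)[OF that])
    then have "quot_scale l c (?cl u) = (\<Union>u'\<in>?cl u. ?cl (\<lambda>\<phi>. c * u \<phi>))"
      unfolding quot_scale_def by (intro SUP_cong refl)
    also have "\<dots> = ?cl (\<lambda>\<phi>. c * u \<phi>)"
      unfolding UN_constant using self[OF u] by (metis empty_iff)
    finally show ?thesis .
  qed
  show "\<forall>C\<in>tempered_mod l. \<forall>D\<in>tempered_mod l. \<Phi> (quot_add l C D) = (\<lambda>\<phi>. \<Phi> C \<phi> + \<Phi> D \<phi>)"
  proof (intro ballI)
    fix C D :: "((real ^ 'n \<Rightarrow> complex) \<Rightarrow> complex) set"
    assume "C \<in> tempered_mod l" "D \<in> tempered_mod l"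
    then obtain u v where u: "u \<in> ?T" "C = ?cl u" and v: "v \<in> ?T" "D = ?cl v"
      using class_obtains by meson
    show "\<Phi> (quot_add l C D) = (\<lambda>\<phi>. \<Phi> C \<phi> + \<Phi> D \<phi>)"
      unfolding u(2) v(2) add[OF u(1) v(1)] \<Phi>[OF u(1)] \<Phi>[OF v(1)] \<Phi>[OF plus[OF u(1) v(1)]]
      by (rule restrict_functional_add)
  qed
  show "\<forall>c. \<forall>C\<in>tempered_mod l. \<Phi> (quot_scale l c C) = (\<lambda>\<phi>. c * \<Phi> C \<phi>)"
  proof (intro allI ballI)
    fix c and C :: "((real ^ 'n \<Rightarrow> complex) \<Rightarrow> complex) set"
    assume "C \<in> tempered_mod l"
    then obtain u where u: "u \<in> ?T" "C = ?cl u"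
      using class_obtains by meson
    show "\<Phi> (quot_scale l c C) = (\<lambda>\<phi>. c * \<Phi> C \<phi>)"
      unfolding u(2) scale[OF u(1)] \<Phi>[OF u(1)] \<Phi>[OF times[OF u(1)]]
      by (rule restrict_functional_scale)
  qed
  show "bij_betw \<Phi> (tempered_mod l) (continuous_dual (schwartz_moment_topology l))"
  proof (rule bij_betw_imageI)
    show "inj_on \<Phi> (tempered_mod l)"
    proof (rule inj_onI)
      fix C D :: "((real ^ 'n \<Rightarrow> complex) \<Rightarrow> complex) set"
      assume CD: "C \<in> tempered_mod l" "D \<in> tempered_mod l" and eq: "\<Phi> C = \<Phi> D"
      obtain u v where u: "u \<in> ?T" "C = ?cl u" and v: "v \<in> ?T" "D = ?cl v"
        using CD class_obtains by meson
      show "C = D"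
        using eq \<Phi>[OF u(1)] \<Phi>[OF v(1)] cl_eq[OF u(1) v(1)] u(2) v(2) by simp
    qed
    show "\<Phi> ` tempered_mod l = continuous_dual (schwartz_moment_topology l)"
    proof
      show "\<Phi> ` tempered_mod l \<subseteq> continuous_dual (schwartz_moment_topology l)"
      proof (rule image_subsetI)
        fix C :: "((real ^ 'n \<Rightarrow> complex) \<Rightarrow> complex) set"
        assume "C \<in> tempered_mod l"
        then obtain u where u: "u \<in> ?T" "C = ?cl u"
          using class_obtains by meson
        show "\<Phi> C \<in> continuous_dual (schwartz_moment_topology l)"
          unfolding u(2) \<Phi>[OF u(1)] by (rule restrict_tempered[OF u(1)])
      qed
      show "continuous_dual (schwartz_moment_topology l) \<subseteq> \<Phi> ` tempered_mod l"
      proof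
        fix v :: "(real ^ 'n \<Rightarrow> complex) \<Rightarrow> complex"
        assume "v \<in> continuous_dual (schwartz_moment_topology l)"
        then obtain u where u: "u \<in> ?T" "?R u = v"
          by (rule extend_to_tempered)
        then show "v \<in> \<Phi> ` tempered_mod l"
          unfolding tempered_mod_def
          by (intro image_eqI[of _ _ "?cl u"] quotientI) (simp_all only: \<Phi>)
      qed
    qed
  qed
qed

end
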